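(* Let $f(x)=\frac{\Gamma(x)^2}{2\Gamma(2x)}$ for $x>0$. For every integer $r\ge0$, $$\sum_{k=1}^{\infty}f^{(r)}(k)=\frac{\pi}{3\sqrt3}\,c_r-\frac{1}{\sqrt3}\sum_{j=1}^{r}2^j\binom{r}{j}c_{r-j}\operatorname{Ls}_{j+1}\left(\frac{\pi}{3}\right).$$
   Context: $f^{(r)}$ is the $r$-th derivative of $f$. The coefficients are $c_r=\left.\frac{d^r}{da^r}\frac{\Gamma(1+a)^2}{\Gamma(1+2a)}\right|_{a=0}$ for $r\ge0$. For $n\ge2$ and $0\le\phi\le2\pi$, the log-sine integral is $\operatorname{Ls}_n(\phi)=-\int_0^\phi\log^{n-1}\left(2\sin\frac{x}{2}\right)dx$. Empty sums are $0$. *)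

theory Defs
  imports "HOL-Analysis.Analysis"
begin

text \<open>
  Only the values on the positive reals matter. Iterated derivatives are written
  \<open>(deriv ^^ r) f_gamma\<close>; they are local, so their values at positive arguments do not
  depend on how \<open>f_gamma\<close> is extended to the remaining reals.
\<close>
definition f_gamma :: "real \<Rightarrow> real" where
  "f_gamma x = Gamma x ^ 2 / (2 * Gamma (2 * x))"

definition c_gamma :: "nat \<Rightarrow> real" where
  "c_gamma r = (deriv ^^ r) (\<lambda>a :: real. Gamma (1 + a) ^ 2 / Gamma (1 + 2 * a)) 0"

text \<open>
  Meant for \<open>n \<ge> 2\<close> and \<open>0 \<le> \<phi> \<le> 2 * pi\<close>. The integrand has an integrable
  logarithmic singularity at 0 (and at \<open>2 * pi\<close>); the value \<open>ln 0 = 0\<close> at these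
  points does not affect the integral.
\<close>
definition Ls :: "nat \<Rightarrow> real \<Rightarrow> real" where
  "Ls n \<phi> = - integral {0..\<phi>} (\<lambda>x. ln (2 * sin (x / 2)) ^ (n - 1))"

end

theory Submission
  imports Defs "HOL-Complex_Analysis.Complex_Analysis"
begin

text \<open>
  Write \<open>C a = \<Gamma>(1 + a)\<^sup>2 / \<Gamma>(1 + 2 a)\<close> and \<open>p x = 2 sin (x / 2)\<close>. The functional equation of
  \<open>\<Gamma>\<close> gives \<open>f (k + 1 + a) = C a * h k a\<close> with \<open>h k\<close> rational in \<open>a\<close> and \<open>h k = O(4\<^sup>-\<^sup>k)\<close>.
  The derivative of \<open>h k a * cos (x / 2) * p x powr (2 a + 2 k + 1)\<close> is \<open>T k x - T (k + 1) x\<close>,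
  where \<open>T k x = (2 a + 2 k + 1) * h k a * p x powr (2 a + 2 k)\<close>. Integrating over \<open>[0, \<pi>/3]\<close>,
  where \<open>p\<close> runs from 0 to 1, and telescoping yields, for \<open>a > 0\<close>,
  \<open>\<Sum>k. h k a = (1 / \<surd>3) * \<integral> p x powr (2 a) dx\<close>.
  Expanding \<open>p x powr (2 a)\<close> in powers of \<open>a\<close> turns the right-hand side into a power series whose
  coefficients are log-sine integrals. Both sides are holomorphic in \<open>\<bar>a\<bar> < 1/4\<close>, so they agree
  near 0 and can be differentiated termwise there; the Leibniz rule for \<open>C a * h k a\<close> gives
  the formula.
\<close>

section \<open>Higher derivatives along the real axis\<close>

text \<open>Bridge from complex analysis back to the real iterated derivatives in
  \<open>f_gamma\<close> and \<open>c_gamma\<close>: a derivative along the real axis of a function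
  that is real there is itself real.\<close>

lemma higher_deriv_complex_of_real:
  fixes F :: "complex \<Rightarrow> complex" and f :: "real \<Rightarrow> real"
  assumes hol: "F holomorphic_on S" and S: "open S"
    and eq: "\<And>x. complex_of_real x \<in> S \<Longrightarrow> F (of_real x) = of_real (f x)"
    and x: "complex_of_real x \<in> S"
  shows "(deriv ^^ n) F (of_real x) = of_real ((deriv ^^ n) f x)"
  using x
proof (induction n arbitrary: x)
  case 0
  then show ?case by (simp add: eq)
next
  case (Suc n)
  let ?F = "(deriv ^^ n) F" and ?f = "(deriv ^^ n) f"
  define D where "D = deriv ?F (of_real x)"
  have "?F holomorphic_on S"
    using hol S by (rule holomorphic_higher_deriv)
  then have "(?F has_field_derivative D) (at (of_real x))"
    unfolding D_def using S Suc.prems by (rule holomorphic_derivI)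
  then have "((\<lambda>y. ?F (of_real y)) has_vector_derivative D) (at x)"
    by (rule has_vector_derivative_real_field)
  moreover have "open (complex_of_real -` S)"
    using S by (intro open_vimage continuous_intros)
  ultimately have v: "((\<lambda>y. complex_of_real (?f y)) has_vector_derivative D) (at x)"
    using Suc by (auto intro: has_vector_derivative_transform_within_open)
  \<comment> \<open>The real part gives a real derivative \<open>Re D\<close>; embedding it back and
    using uniqueness of vector derivatives forces \<open>D\<close> to be real.\<close>
  have "((\<lambda>y. Re (complex_of_real (?f y))) has_vector_derivative Re D) (at x)"
    using v by (rule bounded_linear.has_vector_derivative[OF bounded_linear_Re])
  then have r: "(?f has_vector_derivative Re D) (at x)"
    by simp
  then have "((\<lambda>y. complex_of_real (?f y)) has_vector_derivative of_real (Re D)) (at x)"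
    by (rule bounded_linear.has_vector_derivative[OF bounded_linear_of_real])
  then have "D = of_real (Re D)"
    using v vector_derivative_unique_at by blast
  moreover have "deriv ?f x = Re D"
    using r by (simp add: DERIV_imp_deriv has_real_derivative_iff_has_vector_derivative)
  ultimately show ?case
    by (simp add: D_def)
qed

section \<open>The function 2 sin (x/2) on [0, pi/3]\<close>

text \<open>Length of the chord that subtends the angle \<open>x\<close> in the unit circle;
  log-sine integrals integrate powers of its logarithm.\<close>

definition chord :: "real \<Rightarrow> real" where
  "chord x = 2 * sin (x / 2)"

lemma chord_0 [simp]: "chord 0 = 0"
  by (simp add: chord_def)

lemma chord_pi_third [simp]: "chord (pi / 3) = 1"
  by (simp add: chord_def sin_30)

lemma chord_pos: "0 < x \<Longrightarrow> x \<le> pi / 3 \<Longrightarrow> 0 < chord x"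
  by (auto simp: chord_def intro!: sin_gt_zero)

lemma chord_le_1: "0 \<le> x \<Longrightarrow> x \<le> pi / 3 \<Longrightarrow> chord x \<le> 1"
  unfolding chord_pi_third [symmetric] chord_def
  using pi_ge_zero by (auto intro!: sin_monotone_2pi_le)

text \<open>A linear lower bound controls the logarithmic singularity at 0. It holds because 2 sin y
  - y has derivative 2 cos y - 1, which is nonnegative as long as y is at most pi/3.\<close>

lemma chord_ge:
  assumes "0 \<le> x" "x \<le> pi / 3"
  shows "x / 2 \<le> chord x"
proof -
  define g where "g = (\<lambda>y::real. 2 * sin y - y)"
  have "g 0 \<le> g (x / 2)"
  proof (rule DERIV_nonneg_imp_nondecreasing[where f = g and a = 0 and b = "x / 2"])
    fix y assume y: "0 \<le> y" "y \<le> x / 2"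
    have "cos (pi / 3) \<le> cos y"
      using y assms by (intro cos_monotone_0_pi_le) auto
    then have "0 \<le> 2 * cos y - 1"
      by (simp add: cos_60)
    moreover have "(g has_real_derivative 2 * cos y - 1) (at y)"
      unfolding g_def by (auto intro!: derivative_eq_intros)
    ultimately show "\<exists>D. (g has_real_derivative D) (at y) \<and> 0 \<le> D"
      by blast
  qed (use assms in auto)
  then show ?thesis
    by (simp add: g_def chord_def)
qed

lemma continuous_on_chord [continuous_intros]: "continuous_on A chord"
  unfolding chord_def by (intro continuous_intros) auto

section \<open>The rational factors of f at shifted integers\<close>

text \<open>The quotient of f(k + 1 + a) by Gamma(1 + a)^2 / Gamma(1 + 2a). It is polymorphic so
  that the integral formula can use real arguments and the continuation complex ones.\<close>

primrec hcoeff :: "nat \<Rightarrow> 'a :: real_normed_field \<Rightarrow> 'a" where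
  "hcoeff 0 a = 1 / (2 + 4 * a)"
| "hcoeff (Suc k) a = hcoeff k a * (a + of_nat k + 1) / (4 * a + 4 * of_nat k + 6)"

lemma hcoeff_of_real: "hcoeff k (of_real a) = of_real (hcoeff k a)"
  by (induction k) simp_all

lemma hcoeff_denoms_nonzero:
  fixes z :: complex
  assumes "norm z < 1 / 4"
  shows "2 + 4 * z \<noteq> 0" "4 * z + 4 * of_nat k + 6 \<noteq> 0"
proof -
  have re: "\<bar>Re z\<bar> < 1 / 4"
    using abs_Re_le_cmod[of z] assms by linarith
  then have "Re (2 + 4 * z) \<noteq> 0" "Re (4 * z + 4 * of_nat k + 6) \<noteq> 0"
    by auto
  then show "2 + 4 * z \<noteq> 0" "4 * z + 4 * of_nat k + 6 \<noteq> 0"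
    by (metis zero_complex.sel(1))+
qed

lemma holomorphic_on_hcoeff [holomorphic_intros]:
  "hcoeff k holomorphic_on ball 0 (1 / 4)"
proof (induction k)
  case 0
  have "(\<lambda>z::complex. 1 / (2 + 4 * z)) holomorphic_on ball 0 (1 / 4)"
    using hcoeff_denoms_nonzero(1) by (intro holomorphic_intros) auto
  then show ?case
    by simp
next
  case (Suc k)
  have "(\<lambda>z::complex. hcoeff k z * (z + of_nat k + 1) / (4 * z + 4 * of_nat k + 6))
      holomorphic_on ball 0 (1 / 4)"
    using hcoeff_denoms_nonzero(2) Suc by (intro holomorphic_intros) auto
  then show ?case
    by simp
qed

text \<open>Each recursion step contributes a factor of norm at most 1/4: \<open>4 * ?n\<close> and
  \<open>?d\<close> have equal imaginary parts, and the positive real part of \<open>?d\<close> is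
  larger by 2.\<close>

lemma norm_hcoeff_le:
  fixes z :: complex
  assumes z: "norm z < 1 / 4"
  shows "norm (hcoeff k z) \<le> (1 / 4) ^ k"
proof (induction k)
  case 0
  have "1 \<le> norm (2 + 4 * z)"
    using norm_triangle_ineq2[of 2 "- (4 * z)"] z by (simp add: norm_mult)
  then show ?case
    by (simp add: norm_divide norm_mult divide_simps)
next
  case (Suc k)
  let ?n = "z + of_nat k + 1" and ?d = "4 * z + 4 * of_nat k + 6"
  have re: "\<bar>Re z\<bar> < 1 / 4"
    using abs_Re_le_cmod[of z] z by linarith
  have sq: "(Re (4 * ?n))\<^sup>2 \<le> (Re ?d)\<^sup>2"
    using re by (intro power_mono) auto
  have "4 * norm ?n = norm (4 * ?n)"
    by (simp only: norm_mult) simp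
  also have "\<dots> \<le> norm ?d"
    unfolding norm_complex_def using sq by (intro real_sqrt_le_mono add_mono) simp_all
  finally have "norm ?n / norm ?d \<le> 1 / 4"
    using hcoeff_denoms_nonzero(2)[OF z, of k] by (simp add: divide_simps)
  then have "norm (hcoeff k z) * (norm ?n / norm ?d) \<le> (1 / 4) ^ k * (1 / 4)"
    using Suc by (intro mult_mono) auto
  then show ?case
    by (simp add: norm_mult norm_divide)
qed

lemma f_gamma_plus1:
  assumes "x > 0"
  shows "f_gamma (x + 1) = f_gamma x * x / (4 * x + 2)"
proof -
  have np: "t \<notin> \<int>\<^sub>\<le>\<^sub>0" if "t > 0" for t :: real
    using that by (auto elim!: nonpos_Ints_cases)
  have "Gamma (x + 1) = x * Gamma x"
    using assms np by (intro Gamma_plus1) auto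
  moreover have "Gamma (2 * (x + 1)) = (2 * x + 1) * (2 * x) * Gamma (2 * x)"
    using Gamma_plus1[OF np, of "2 * x"] Gamma_plus1[OF np, of "2 * x + 1"] assms
    by (simp add: algebra_simps)
  moreover have "Gamma (2 * x) > 0"
    using assms by (intro Gamma_real_pos) auto
  ultimately show ?thesis
    using assms by (simp add: f_gamma_def divide_simps power2_eq_square)
qed

text \<open>The functional equation of f reproduces the recursion of \<open>hcoeff\<close>. Negative
  \<open>a\<close> are included because derivatives at 0 need a two-sided neighbourhood.\<close>

lemma f_gamma_eq_hcoeff:
  assumes a: "- 1 / 4 < a"
  shows "f_gamma (real (Suc k) + a) = Gamma (1 + a) ^ 2 / Gamma (1 + 2 * a) * hcoeff k a"
proof (induction k)
  case 0
  have "1 + 2 * a \<notin> \<int>\<^sub>\<le>\<^sub>0"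
    using a by (auto elim!: nonpos_Ints_cases)
  then have "Gamma (2 * (1 + a)) = (1 + 2 * a) * Gamma (1 + 2 * a)"
    using Gamma_plus1[of "1 + 2 * a"] by (simp add: algebra_simps)
  then show ?case
    using a by (simp add: f_gamma_def divide_simps)
next
  case (Suc k)
  have "f_gamma (real (Suc (Suc k)) + a) = f_gamma ((real (Suc k) + a) + 1)"
    by (simp add: algebra_simps)
  also have "\<dots> = f_gamma (real (Suc k) + a) * (real (Suc k) + a) / (4 * (real (Suc k) + a) + 2)"
    using a by (intro f_gamma_plus1) auto
  also have "\<dots> = Gamma (1 + a) ^ 2 / Gamma (1 + 2 * a) * hcoeff (Suc k) a"
    unfolding Suc.IH by (simp add: algebra_simps)
  finally show ?case .
qed

lemma hcoeff_nonneg_le: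
  fixes a :: real
  assumes "a \<ge> 0"
  shows "0 \<le> hcoeff k a" "hcoeff k a \<le> (1 / 4) ^ k"
proof -
  show nn: "0 \<le> hcoeff k a" for k
    using assms by (induction k) auto
  show "hcoeff k a \<le> (1 / 4) ^ k"
  proof (induction k)
    case 0
    then show ?case using assms by (simp add: divide_simps)
  next
    case (Suc k)
    have "(a + of_nat k + 1) / (4 * a + 4 * of_nat k + 6) \<le> 1 / 4"
      using assms by (simp add: divide_simps)
    then have "hcoeff k a * ((a + of_nat k + 1) / (4 * a + 4 * of_nat k + 6)) \<le> (1 / 4) ^ k * (1 / 4)"
      using Suc assms nn by (intro mult_mono) auto
    then show ?case
      by simp
  qed
qed

section \<open>Telescoping integrals of powers of the chord\<close>

lemma continuous_on_chord_powr:
  assumes "b > 0"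
  shows "continuous_on {0..pi / 3} (\<lambda>x. chord x powr b)"
proof -
  have "0 \<le> chord x" if "x \<in> {0..pi / 3}" for x
    using chord_ge[of x] that by auto
  then show ?thesis
    using assms by (intro continuous_on_powr' continuous_intros) auto
qed

text \<open>The identity cos^2(x/2) = 1 - \<open>chord x\<close>^2 / 4 turns the product rule into a
  combination of two powers of \<open>chord\<close>, with exponents differing by 2.\<close>

lemma has_real_derivative_cos_chord_powr:
  assumes "0 < x" "x < pi / 3"
  shows "((\<lambda>x. cos (x / 2) * chord x powr (b + 1)) has_real_derivative
    (b + 1) * chord x powr b - (b + 2) / 4 * chord x powr (b + 2)) (at x)"
proof -
  have pos: "0 < chord x"
    using assms by (intro chord_pos) auto
  have c: "(chord has_real_derivative cos (x / 2)) (at x)"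
    unfolding chord_def by (auto intro!: derivative_eq_intros)
  have cos': "((\<lambda>x. cos (x / 2)) has_real_derivative - sin (x / 2) / 2) (at x)"
    by (auto intro!: derivative_eq_intros)
  have powr1: "chord x powr (b + 1) = chord x powr b * chord x"
    using pos by (simp add: powr_add)
  have powr2: "chord x powr (b + 2) = chord x powr b * (chord x)\<^sup>2"
    using pos by (simp add: powr_add powr_numeral)
  have cos2: "(cos (x / 2))\<^sup>2 = 1 - (chord x)\<^sup>2 / 4"
    by (simp add: chord_def power_mult_distrib cos_squared_eq)
  have "((\<lambda>x. chord x powr (b + 1)) has_real_derivative (b + 1) * chord x powr b * cos (x / 2)) (at x)"
    using DERIV_fun_powr[OF c pos, of "b + 1"] by simp
  then have "((\<lambda>x. cos (x / 2) * chord x powr (b + 1)) has_real_derivative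
      - sin (x / 2) / 2 * chord x powr (b + 1)
        + (b + 1) * chord x powr b * (cos (x / 2) * cos (x / 2))) (at x)"
    by (rule DERIV_cong[OF DERIV_mult[OF cos']]) (simp add: algebra_simps)
  moreover have "- sin (x / 2) / 2 * chord x powr (b + 1)
        + (b + 1) * chord x powr b * (cos (x / 2) * cos (x / 2))
      = (b + 1) * chord x powr b - (b + 2) / 4 * chord x powr (b + 2)"
  proof -
    have s: "sin (x / 2) / 2 = chord x / 4"
      by (simp add: chord_def)
    show ?thesis
      unfolding powr1 powr2 power2_eq_square[symmetric] cos2 minus_divide_left[symmetric] s
      by (simp add: field_simps power2_eq_square)
  qed
  ultimately show ?thesis
    by simp
qed

lemma hcoeff_sums:
  fixes a :: real
  assumes a: "a > 0"
  shows "(\<lambda>k. hcoeff k a) sums (integral {0..pi / 3} (\<lambda>x. chord x powr (2 * a)) / sqrt 3)"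
proof -
  define J where "J = (\<lambda>k::nat. integral {0..pi / 3} (\<lambda>x. chord x powr (2 * a + 2 * real k)))"
  define T where "T = (\<lambda>k. (2 * a + 2 * real k + 1) * hcoeff k a * J k)"
  have J: "((\<lambda>x. chord x powr (2 * a + 2 * real k)) has_integral J k) {0..pi / 3}" for k
    unfolding J_def using a
    by (intro integrable_integral integrable_continuous_interval continuous_on_chord_powr) auto
  have step: "hcoeff k a * sqrt 3 / 2 = T k - T (Suc k)" for k
  proof -
    define b where "b = 2 * a + 2 * real k"
    have b: "b > 0"
      using a by (simp add: b_def)
    \<comment> \<open>The derivative is known only in the open interval, since \<open>chord\<close>
      vanishes at 0; continuity up to the endpoints suffices. The boundary term is cos(pi/6) = sqrt
      3 / 2 at pi/3, and 0 at 0.\<close>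
    have "((\<lambda>x. (b + 1) * chord x powr b - (b + 2) / 4 * chord x powr (b + 2)) has_integral
        cos (pi / 3 / 2) * chord (pi / 3) powr (b + 1) - cos (0 / 2) * chord 0 powr (b + 1)) {0..pi / 3}"
      using b has_real_derivative_cos_chord_powr
      by (intro fundamental_theorem_of_calculus_interior)
        (auto intro!: continuous_intros continuous_on_chord_powr
          simp: has_real_derivative_iff_has_vector_derivative[symmetric])
    then have "((\<lambda>x. (b + 1) * chord x powr b - (b + 2) / 4 * chord x powr (b + 2)) has_integral
        sqrt 3 / 2) {0..pi / 3}"
      by (simp add: cos_30)
    moreover have "((\<lambda>x. (b + 1) * chord x powr b - (b + 2) / 4 * chord x powr (b + 2)) has_integral
        (b + 1) * J k - (b + 2) / 4 * J (Suc k)) {0..pi / 3}"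
      using J[of k] J[of "Suc k"]
      by (intro has_integral_diff has_integral_mult_right) (simp_all add: b_def algebra_simps)
    ultimately have "sqrt 3 / 2 = (b + 1) * J k - (b + 2) / 4 * J (Suc k)"
      by (rule has_integral_unique)
    then have "hcoeff k a * (sqrt 3 / 2) = hcoeff k a * ((b + 1) * J k - (b + 2) / 4 * J (Suc k))"
      by (rule arg_cong)
    then have "hcoeff k a * sqrt 3 / 2 = hcoeff k a * (b + 1) * J k - hcoeff k a * (b + 2) / 4 * J (Suc k)"
      by (simp add: right_diff_distrib mult.assoc)
    \<comment> \<open>This is the recursion of \<open>hcoeff\<close>, as
      \<open>4 * a + 4 * k + 6\<close> is twice \<open>2 * a + 2 * k + 3\<close>; it makes the
      second term equal to \<open>T (Suc k)\<close>.\<close>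
    also have "hcoeff k a * (b + 2) / 4 = (2 * a + 2 * real (Suc k) + 1) * hcoeff (Suc k) a"
      using a by (simp add: b_def divide_simps) (simp add: algebra_simps)
    finally show ?thesis
      by (simp add: T_def b_def mult_ac del: hcoeff.simps of_nat_Suc)
  qed
  \<comment> \<open>The integrals \<open>J k\<close> stay bounded because \<open>chord\<close> is at
    most 1, while \<open>hcoeff\<close> decays geometrically against a linear factor.\<close>
  have "T \<longlonglongrightarrow> 0"
  proof (rule tendsto_sandwich)
    have J01: "0 \<le> J k \<and> J k \<le> pi / 3" for k
    proof
      show "0 \<le> J k"
        using J by (rule has_integral_nonneg) auto
      have "chord x powr (2 * a + 2 * real k) \<le> 1" if "x \<in> {0..pi / 3}" for x
        using that a chord_le_1[of x] chord_ge[of x] by (intro powr_le1) auto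
      then show "J k \<le> pi / 3"
        using has_integral_le[OF J has_integral_const_real[of 1 0 "pi / 3"]] by auto
    qed
    show "\<forall>\<^sub>F k in sequentially. 0 \<le> T k"
      using J01 hcoeff_nonneg_le(1)[of a] a by (auto simp: T_def)
    show "\<forall>\<^sub>F k in sequentially. T k \<le> (2 * a + 2 * real k + 1) * (1 / 4) ^ k * (pi / 3)"
      unfolding T_def using J01 hcoeff_nonneg_le[of a] a
      by (intro always_eventually allI mult_mono mult_nonneg_nonneg) auto
    show "(\<lambda>k. (2 * a + 2 * real k + 1) * (1 / 4) ^ k * (pi / 3)) \<longlonglongrightarrow> 0"
      by real_asymp
  qed auto
  from telescope_sums'[OF this] have "(\<lambda>k. hcoeff k a * sqrt 3 / 2) sums T 0"
    by (simp add: step)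
  from sums_mult[OF this, of "2 / sqrt 3"] have "(\<lambda>k. hcoeff k a) sums (2 / sqrt 3 * T 0)"
    by simp
  \<comment> \<open>Here \<open>(2 * a + 1) * hcoeff 0 a = 1 / 2\<close>.\<close>
  also have "2 / sqrt 3 * T 0 = J 0 / sqrt 3"
    using a by (simp add: T_def divide_simps)
  finally show ?thesis
    by (simp add: J_def)
qed

section \<open>Expansion in log-sine integrals\<close>

text \<open>The logarithm is nonpositive here, so the left side is
  \<open>chord x powr (- 1 / 2)\<close>. The resulting majorant is integrable at 0 because its
  exponent exceeds -1; the factor 1/2 matches the bound on |2a| when |a| is at most 1/4.\<close>

lemma exp_half_abs_ln_chord_le:
  assumes "0 < x" "x \<le> pi / 3"
  shows "exp (\<bar>ln (chord x)\<bar> / 2) \<le> (x / 2) powr (- 1 / 2)"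
proof -
  have pos: "0 < chord x"
    using assms by (rule chord_pos)
  have "ln (chord x) \<le> 0"
    using pos chord_le_1[of x] assms by simp
  moreover have "ln (x / 2) \<le> ln (chord x)"
    using chord_ge[of x] assms by (intro ln_mono) auto
  ultimately show ?thesis
    using assms by (simp add: powr_def)
qed

lemma half_powr_integrable:
  "(\<lambda>x::real. (x / 2) powr (- 1 / 2)) integrable_on {0<..<pi / 3}"
proof -
  have "(\<lambda>x::real. x powr (- 1 / 2) * (1 / 2) powr (- 1 / 2)) integrable_on {0..pi / 3}"
    using has_integral_powr_from_0[of "- 1 / 2" "pi / 3"]
    by (intro integrable_on_mult_left) (auto simp: has_integral_integrable_integral)
  then have "(\<lambda>x::real. x powr (- 1 / 2) * (1 / 2) powr (- 1 / 2)) integrable_on {0<..<pi / 3}"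
    by (simp only: integrable_on_Icc_iff_Ioo)
  then show ?thesis
  proof (rule integrable_eq)
    fix x :: real assume "x \<in> {0<..<pi / 3}"
    then show "x powr (- 1 / 2) * (1 / 2) powr (- 1 / 2) = (x / 2) powr (- 1 / 2)"
      using powr_mult[of x "1 / 2" "- 1 / 2"] by simp
  qed
qed

lemma sum_le_exp:
  fixes x :: real
  assumes "0 \<le> x" "finite I"
  shows "(\<Sum>j\<in>I. x ^ j / fact j) \<le> exp x"
proof -
  have "(\<lambda>j. x ^ j / fact j) sums exp x"
    using exp_converges[of x] by (simp add: divide_inverse mult.commute)
  then show ?thesis
    using assms sum_le_suminf[of "\<lambda>j. x ^ j / fact j" I] by (simp add: sums_iff)
qed

lemma abs_exp_partial_sum_le:
  fixes u :: real
  assumes "\<bar>a\<bar> \<le> 1 / 4"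
  shows "\<bar>\<Sum>j<n. (2 * a) ^ j / fact j * u ^ j\<bar> \<le> exp (\<bar>u\<bar> / 2)"
proof -
  have "\<bar>\<Sum>j<n. (2 * a) ^ j / fact j * u ^ j\<bar> \<le> (\<Sum>j<n. (\<bar>u\<bar> / 2) ^ j / fact j)"
  proof (rule order_trans[OF sum_abs], rule sum_mono)
    fix j
    have "(\<bar>2 * a\<bar> * \<bar>u\<bar>) ^ j \<le> (\<bar>u\<bar> / 2) ^ j"
      using assms mult_right_mono[of "\<bar>2 * a\<bar>" "1 / 2" "\<bar>u\<bar>"] by (intro power_mono) auto
    then show "\<bar>(2 * a) ^ j / fact j * u ^ j\<bar> \<le> (\<bar>u\<bar> / 2) ^ j / fact j"
      by (simp add: abs_mult power_abs power_mult_distrib divide_right_mono)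
  qed
  also have "\<dots> \<le> exp (\<bar>u\<bar> / 2)"
    by (rule sum_le_exp) auto
  finally show ?thesis .
qed

lemma exp_mult_sums:
  fixes b u :: real
  shows "(\<lambda>j. b ^ j / fact j * u ^ j) sums exp (b * u)"
  using exp_converges[of "b * u"] by (simp add: power_mult_distrib divide_inverse mult_ac)

text \<open>A single term of the exponential series of |ln (chord x)| / 2 is at most its sum, so
  each power of the logarithm is dominated by a multiple of
  \<open>(x / 2) powr (- 1 / 2)\<close>.\<close>

lemma ln_chord_power_integrable:
  "(\<lambda>x. ln (chord x) ^ j) integrable_on {0<..<pi / 3}"
proof (rule measurable_bounded_by_integrable_imp_integrable)
  have "continuous_on {0<..<pi / 3} (\<lambda>x. ln (chord x) ^ j)"
    using chord_pos by (intro continuous_intros) (auto simp: less_imp_neq[symmetric])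
  then show "(\<lambda>x. ln (chord x) ^ j) \<in> borel_measurable (lebesgue_on {0<..<pi / 3})"
    by (intro continuous_imp_measurable_on_sets_lebesgue) auto
  show "(\<lambda>x. 2 ^ j * fact j * (x / 2) powr (- 1 / 2)) integrable_on {0<..<pi / 3}"
    using half_powr_integrable by (rule integrable_on_mult_right)
  fix x :: real assume x: "x \<in> {0<..<pi / 3}"
  let ?u = "\<bar>ln (chord x)\<bar>"
  have "(?u / 2) ^ j / fact j \<le> exp (?u / 2)"
    using sum_le_exp[of "?u / 2" "{j}"] by simp
  also have "\<dots> \<le> (x / 2) powr (- 1 / 2)"
    using x by (intro exp_half_abs_ln_chord_le) auto
  finally show "norm (ln (chord x) ^ j) \<le> 2 ^ j * fact j * (x / 2) powr (- 1 / 2)"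
    by (simp add: field_simps power_abs)
qed auto

text \<open>The exponential series of 2a ln (chord x) is integrated termwise by dominated
  convergence.\<close>

lemma chord_powr_integral_sums:
  assumes a: "\<bar>a\<bar> \<le> 1 / 4"
  shows "(\<lambda>j. (2 * a) ^ j / fact j * integral {0..pi / 3} (\<lambda>x. ln (chord x) ^ j))
    sums integral {0..pi / 3} (\<lambda>x. chord x powr (2 * a))"
proof -
  \<comment> \<open>The endpoint 0 must be left out: there \<open>ln 0 = 0\<close> makes the
    nonempty partial sums 1, while the claimed limit and the majorant are 0.\<close>
  let ?S = "{0<..<pi / 3}"
  have "(\<lambda>n. integral ?S (\<lambda>x. \<Sum>j<n. (2 * a) ^ j / fact j * ln (chord x) ^ j))
      \<longlonglongrightarrow> integral ?S (\<lambda>x. chord x powr (2 * a))"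
  proof (rule dominated_convergence(2))
    show "(\<lambda>x. \<Sum>j<n. (2 * a) ^ j / fact j * ln (chord x) ^ j) integrable_on ?S" for n
      by (intro integrable_sum integrable_on_mult_right ln_chord_power_integrable) auto
    show "norm (\<Sum>j<n. (2 * a) ^ j / fact j * ln (chord x) ^ j) \<le> (x / 2) powr (- 1 / 2)"
      if "x \<in> ?S" for n x
      unfolding real_norm_def
      using abs_exp_partial_sum_le[OF a] exp_half_abs_ln_chord_le by (rule order_trans) (use that in auto)
    show "(\<lambda>n. \<Sum>j<n. (2 * a) ^ j / fact j * ln (chord x) ^ j) \<longlonglongrightarrow> chord x powr (2 * a)"
      if "x \<in> ?S" for x
    proof -
      have "chord x powr (2 * a) = exp (2 * a * ln (chord x))"
        using chord_pos[of x] that by (simp add: powr_def)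
      then show ?thesis
        using exp_mult_sums[of "2 * a" "ln (chord x)"] by (simp only: sums_def)
    qed
  qed (rule half_powr_integrable)
  also have "(\<lambda>n. integral ?S (\<lambda>x. \<Sum>j<n. (2 * a) ^ j / fact j * ln (chord x) ^ j))
      = (\<lambda>n. \<Sum>j<n. (2 * a) ^ j / fact j * integral ?S (\<lambda>x. ln (chord x) ^ j))"
  proof
    fix n
    have "integral ?S (\<lambda>x. \<Sum>j<n. (2 * a) ^ j / fact j * ln (chord x) ^ j)
        = (\<Sum>j<n. integral ?S (\<lambda>x. (2 * a) ^ j / fact j * ln (chord x) ^ j))"
      by (intro integral_sum integrable_on_mult_right ln_chord_power_integrable) auto
    then show "integral ?S (\<lambda>x. \<Sum>j<n. (2 * a) ^ j / fact j * ln (chord x) ^ j)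
        = (\<Sum>j<n. (2 * a) ^ j / fact j * integral ?S (\<lambda>x. ln (chord x) ^ j))"
      by (simp only: integral_mult_right)
  qed
  finally show ?thesis
    by (simp only: sums_def integral_open_interval_real)
qed

abbreviation (input) lnint :: "nat \<Rightarrow> real" where
  "lnint j \<equiv> integral {0..pi / 3} (\<lambda>x. ln (chord x) ^ j)"

text \<open>Taylor series in \<open>a\<close> of the integral of \<open>chord x powr (2 * a)\<close>
  divided by sqrt 3, with complex coefficients so that its evaluation can be treated as a
  holomorphic function.\<close>

definition lnint_fps :: "complex fps" where
  "lnint_fps = Abs_fps (\<lambda>j. of_real (2 ^ j * lnint j / (fact j * sqrt 3)))"

lemma lnint_fps_sums:
  assumes "\<bar>a\<bar> \<le> 1 / 4"
  shows "(\<lambda>j. fps_nth lnint_fps j * of_real a ^ j) sums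
    of_real (integral {0..pi / 3} (\<lambda>x. chord x powr (2 * a)) / sqrt 3)"
proof -
  have "(\<lambda>j. (2 * a) ^ j / fact j * lnint j / sqrt 3)
      sums (integral {0..pi / 3} (\<lambda>x. chord x powr (2 * a)) / sqrt 3)"
    using assms by (intro sums_divide chord_powr_integral_sums)
  then have "(\<lambda>j. complex_of_real ((2 * a) ^ j / fact j * lnint j / sqrt 3))
      sums of_real (integral {0..pi / 3} (\<lambda>x. chord x powr (2 * a)) / sqrt 3)"
    by (rule sums_of_real)
  then show ?thesis
    by (simp add: lnint_fps_def power_mult_distrib mult_ac)
qed

text \<open>Convergence at the single point 1/4, the extreme case allowed by the integral expansion,
  already bounds the radius from below.\<close>

lemma fps_conv_radius_lnint_fps: "fps_conv_radius lnint_fps \<ge> 1 / 4"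
proof -
  have "summable (\<lambda>j. fps_nth lnint_fps j * of_real (1 / 4) ^ j)"
    using lnint_fps_sums[of "1 / 4"] by (intro sums_summable) auto
  from conv_radius_geI[OF this] show ?thesis
    by (simp add: fps_conv_radius_def norm_divide one_ereal_def)
qed

lemma holomorphic_on_lnint_fps: "eval_fps lnint_fps holomorphic_on ball 0 (1 / 4)"
proof (rule holomorphic_on_eval_fps, rule subsetI)
  fix z :: complex assume "z \<in> ball 0 (1 / 4)"
  then have "ereal (norm z) < 1 / 4"
    by (simp add: one_ereal_def)
  then show "z \<in> eball 0 (fps_conv_radius lnint_fps)"
    using fps_conv_radius_lnint_fps by (simp add: in_eball_iff)
qed

lemma higher_deriv_lnint_fps:
  "(deriv ^^ j) (eval_fps lnint_fps) 0 = of_real (2 ^ j * lnint j / sqrt 3)"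
proof -
  have "0 < fps_conv_radius lnint_fps"
    using fps_conv_radius_lnint_fps by (rule less_le_trans[rotated]) (simp add: one_ereal_def)
  from fps_nth_conv_deriv[OF this, of j] show ?thesis
    by (simp add: lnint_fps_def field_simps)
qed

section \<open>Analytic continuation and termwise differentiation\<close>

lemma hcoeff_uniform_limit:
  "uniform_limit (ball 0 (1 / 4)) (\<lambda>n z. \<Sum>k<n. hcoeff k z)
    (\<lambda>z :: complex. \<Sum>k. hcoeff k z) sequentially"
  using norm_hcoeff_le by (intro Weierstrass_m_test[where M = "\<lambda>k. (1 / 4) ^ k"])
    (auto intro: summable_geometric)

text \<open>The integral formula covers only real \<open>a > 0\<close>, whereas derivatives at 0 are
  wanted. Both sides are holomorphic in the disc and agree on the real interval (0, 1/4), which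
  accumulates at 0, so the identity theorem applies.\<close>

lemma suminf_hcoeff_eq:
  fixes z :: complex
  assumes "z \<in> ball 0 (1 / 4)"
  shows "(\<Sum>k. hcoeff k z) = eval_fps lnint_fps z"
proof -
  let ?U = "complex_of_real ` {0<..<1 / 4}"
  have hol: "(\<lambda>z :: complex. \<Sum>k. hcoeff k z) holomorphic_on ball 0 (1 / 4)"
  proof (rule holomorphic_uniform_sequence)
    fix x :: complex assume "x \<in> ball 0 (1 / 4)"
    then obtain d where d: "0 < d" "cball x d \<subseteq> ball 0 (1 / 4)"
      using open_ball open_contains_cball by blast
    then show "\<exists>d>0. cball x d \<subseteq> ball 0 (1 / 4) \<and>
        uniform_limit (cball x d) (\<lambda>n z. \<Sum>k<n. hcoeff k z) (\<lambda>z. \<Sum>k. hcoeff k z) sequentially"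
      using uniform_limit_on_subset[OF hcoeff_uniform_limit] by blast
  qed (auto intro!: holomorphic_intros)
  have hol_diff: "(\<lambda>z. (\<Sum>k. hcoeff k z) - eval_fps lnint_fps z) holomorphic_on ball 0 (1 / 4)"
    using hol holomorphic_on_lnint_fps by (rule holomorphic_on_diff)
  have "(0 :: complex) islimpt ?U"
    unfolding islimpt_approachable
  proof (intro allI impI)
    fix e :: real assume "e > 0"
    then show "\<exists>x'\<in>?U. x' \<noteq> 0 \<and> dist x' 0 < e"
      by (intro bexI[of _ "of_real (min e (1 / 4) / 2)"] imageI) auto
  qed
  moreover have "(\<Sum>k. hcoeff k z) - eval_fps lnint_fps z = 0" if "z \<in> ?U" for z
  proof -
    obtain a where z: "z = of_real a" and "a \<in> {0<..<1 / 4}"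
      using \<open>z \<in> ?U\<close> by (rule imageE)
    then have a: "0 < a" "a < 1 / 4"
      by auto
    have "(\<lambda>k. complex_of_real (hcoeff k a)) sums
        of_real (integral {0..pi / 3} (\<lambda>x. chord x powr (2 * a)) / sqrt 3)"
      using a by (intro sums_of_real hcoeff_sums)
    then have "(\<Sum>k. hcoeff k z) = of_real (integral {0..pi / 3} (\<lambda>x. chord x powr (2 * a)) / sqrt 3)"
      by (simp only: z hcoeff_of_real sums_iff)
    moreover have "eval_fps lnint_fps z = of_real (integral {0..pi / 3} (\<lambda>x. chord x powr (2 * a)) / sqrt 3)"
      using lnint_fps_sums[of a] a unfolding eval_fps_def sums_iff z by auto
    ultimately show ?thesis
      by simp
  qed
  ultimately have "(\<Sum>k. hcoeff k z) - eval_fps lnint_fps z = 0"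
    by (rule analytic_continuation[OF hol_diff open_ball connected_ball _ _ _ _ assms, of ?U 0, rotated 2])
      auto
  then show ?thesis
    by simp
qed

text \<open>Uniform convergence of holomorphic partial sums passes to all derivatives, so the series
  may be differentiated termwise at 0.\<close>

lemma higher_deriv_hcoeff_sums:
  "(\<lambda>k. (deriv ^^ j) (hcoeff k) (0 :: complex)) sums of_real (2 ^ j * lnint j / sqrt 3)"
proof -
  have z: "(0 :: complex) \<in> ball 0 (1 / 4)"
    by simp
  have "uniform_limit (ball 0 (1 / 4)) (\<lambda>n z. \<Sum>k<n. hcoeff k z) (eval_fps lnint_fps) sequentially"
  proof (rule uniform_limit_cong'[THEN iffD1, rotated -1])
    show "uniform_limit (ball 0 (1 / 4)) (\<lambda>n z. \<Sum>k<n. hcoeff k z)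
        (\<lambda>z :: complex. \<Sum>k. hcoeff k z) sequentially"
      by (rule hcoeff_uniform_limit)
  qed (simp_all only: suminf_hcoeff_eq)
  then have "(\<lambda>n. (deriv ^^ j) (\<lambda>z. \<Sum>k<n. hcoeff k z) 0) \<longlonglongrightarrow> (deriv ^^ j) (eval_fps lnint_fps) 0"
    by (rule higher_deriv_complex_uniform_limit[OF _ _ _ open_ball z])
      (auto intro!: holomorphic_intros always_eventually)
  moreover have "(deriv ^^ j) (\<lambda>z. \<Sum>k<n. hcoeff k z) 0 = (\<Sum>k<n. (deriv ^^ j) (hcoeff k) (0 :: complex))" for n
  proof (induction n)
    case 0
    show ?case by simp
  next
    case (Suc n)
    have "(deriv ^^ j) (\<lambda>z. (\<Sum>k<n. hcoeff k z) + hcoeff n z) (0 :: complex)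
        = (deriv ^^ j) (\<lambda>z. \<Sum>k<n. hcoeff k z) 0 + (deriv ^^ j) (hcoeff n) 0"
      using z by (intro higher_deriv_add[where S = "ball 0 (1 / 4)"]) (auto intro!: holomorphic_intros)
    then show ?case
      using Suc by simp
  qed
  ultimately show ?thesis
    by (simp add: sums_def higher_deriv_lnint_fps)
qed

section \<open>The Gamma factor, the Leibniz rule and the final sum\<close>

definition gamma_quotient :: "complex \<Rightarrow> complex" where
  "gamma_quotient z = Gamma (1 + z) ^ 2 / Gamma (1 + 2 * z)"

lemma one_plus_notin_nonpos_Ints:
  fixes z :: complex
  assumes "norm z < 1"
  shows "1 + z \<notin> \<int>\<^sub>\<le>\<^sub>0"
proof
  assume "1 + z \<in> \<int>\<^sub>\<le>\<^sub>0"
  then obtain n where "1 + z = - of_nat n"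
    by (rule nonpos_Ints_cases')
  then have "1 + Re z = - real n"
    by (metis Re_complex_of_real of_real_of_nat_eq one_complex.sel(1) plus_complex.sel(1) uminus_complex.sel(1))
  then show False
    using abs_Re_le_cmod[of z] assms by linarith
qed

text \<open>In this disc both Gamma arguments avoid the poles, and Gamma has no zeros there, so the
  division is harmless.\<close>

lemma holomorphic_on_gamma_quotient: "gamma_quotient holomorphic_on ball 0 (1 / 4)"
proof -
  have "1 + z \<notin> \<int>\<^sub>\<le>\<^sub>0" "1 + 2 * z \<notin> \<int>\<^sub>\<le>\<^sub>0" if "z \<in> ball 0 (1 / 4)" for z :: complex
    using that by (auto intro!: one_plus_notin_nonpos_Ints simp: norm_mult)
  then show ?thesis
    unfolding gamma_quotient_def by (intro holomorphic_intros) (auto simp: Gamma_eq_zero_iff)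
qed

lemma gamma_quotient_of_real: "gamma_quotient (of_real a) = of_real (Gamma (1 + a) ^ 2 / Gamma (1 + 2 * a))"
proof -
  have "1 + complex_of_real a = of_real (1 + a)" "1 + 2 * complex_of_real a = of_real (1 + 2 * a)"
    by simp_all
  then show ?thesis
    by (simp only: gamma_quotient_def Gamma_complex_of_real of_real_power of_real_divide)
qed

lemma higher_deriv_gamma_quotient: "(deriv ^^ r) gamma_quotient 0 = of_real (c_gamma r)"
  using higher_deriv_complex_of_real[OF holomorphic_on_gamma_quotient open_ball gamma_quotient_of_real, of 0 r]
  by (simp add: c_gamma_def)

text \<open>Translated to 0, f extends holomorphically as the product
  \<open>hcoeff k z * gamma_quotient z\<close>, to which the Leibniz rule applies.\<close>

lemma higher_deriv_f_gamma:
  "complex_of_real ((deriv ^^ r) f_gamma (real (Suc k))) =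
    (\<Sum>j=0..r. of_nat (r choose j) * (deriv ^^ j) (hcoeff k) 0 * of_real (c_gamma (r - j)))"
proof -
  define m where "m = real (Suc k)"
  define F where "F = (\<lambda>z. hcoeff k z * gamma_quotient z)"
  let ?B = "ball (complex_of_real m) (1 / 4)"
  have hol: "F holomorphic_on ball 0 (1 / 4)"
    unfolding F_def by (intro holomorphic_intros holomorphic_on_gamma_quotient)
  \<comment> \<open>The translation is written as \<open>1 * w + - of_real m\<close> to fit the rule
    for higher derivatives of a composition with an affine map.\<close>
  have shift: "1 * w + - of_real m \<in> ball 0 (1 / 4)" if "w \<in> ?B" for w :: complex
    using that by (simp add: dist_norm norm_minus_commute)
  have "(F \<circ> (\<lambda>w. 1 * w + - of_real m)) holomorphic_on ?B"
  proof (rule holomorphic_on_compose_gen[OF _ hol])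
    show "(\<lambda>w. 1 * w + - of_real m) ` ?B \<subseteq> ball 0 (1 / 4)"
      using shift by (rule image_subsetI)
  qed (intro holomorphic_intros)
  then have holF: "(\<lambda>w. F (1 * w + - of_real m)) holomorphic_on ?B"
    by (simp only: o_def)
  have "F (1 * of_real x + - of_real m) = of_real (f_gamma x)" if x: "complex_of_real x \<in> ?B" for x
  proof -
    have "complex_of_real (x - m) \<in> ball 0 (1 / 4)"
      using shift[OF x] by simp
    then have "\<bar>x - m\<bar> < 1 / 4"
      by (simp only: mem_ball dist_0_norm norm_of_real)
    then have "- 1 / 4 < x - m"
      by linarith
    from f_gamma_eq_hcoeff[OF this, of k]
    have "f_gamma x = hcoeff k (x - m) * (Gamma (1 + (x - m)) ^ 2 / Gamma (1 + 2 * (x - m)))"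
      unfolding m_def[symmetric] by (simp add: mult.commute)
    moreover have "1 * complex_of_real x + - of_real m = of_real (x - m)"
      by simp
    ultimately show ?thesis
      by (simp only: F_def hcoeff_of_real gamma_quotient_of_real of_real_mult)
  qed
  then have "(deriv ^^ r) (\<lambda>w. F (1 * w + - of_real m)) (of_real m) = of_real ((deriv ^^ r) f_gamma m)"
    by (rule higher_deriv_complex_of_real[OF holF open_ball]) simp_all
  moreover have "(deriv ^^ r) (\<lambda>w. F (1 * w + - of_real m)) (of_real m)
      = 1 ^ r * (deriv ^^ r) F (1 * of_real m + - of_real m)"
    by (rule higher_deriv_compose_linear'[where S = ?B, OF hol open_ball open_ball _ shift]) simp_all
  ultimately have "of_real ((deriv ^^ r) f_gamma m) = (deriv ^^ r) F 0"
    by simp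
  also have "\<dots> = (\<Sum>j=0..r. of_nat (r choose j) * (deriv ^^ j) (hcoeff k) 0 * (deriv ^^ (r - j)) gamma_quotient 0)"
    unfolding F_def
    by (rule higher_deriv_mult[OF holomorphic_on_hcoeff holomorphic_on_gamma_quotient open_ball]) simp
  finally show ?thesis
    by (simp only: higher_deriv_gamma_quotient m_def)
qed

theorem corollary1p2:
  fixes r :: nat
  shows "(\<lambda>k. (deriv ^^ r) f_gamma (real (Suc k))) sums
    (pi / (3 * sqrt 3) * c_gamma r
      - 1 / sqrt 3 * (\<Sum>j = 1..r. 2 ^ j * real (r choose j) * c_gamma (r - j) * Ls (j + 1) (pi / 3)))"
proof -
  let ?t = "\<lambda>j. real (r choose j) * (2 ^ j * lnint j / sqrt 3) * c_gamma (r - j)"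
  have "(\<lambda>k. \<Sum>j=0..r. of_nat (r choose j) * (deriv ^^ j) (hcoeff k) (0 :: complex) * of_real (c_gamma (r - j)))
      sums (\<Sum>j=0..r. of_nat (r choose j) * of_real (2 ^ j * lnint j / sqrt 3) * of_real (c_gamma (r - j)))"
    by (intro sums_sum sums_mult sums_mult2 higher_deriv_hcoeff_sums)
  then have "(\<lambda>k. complex_of_real ((deriv ^^ r) f_gamma (real (Suc k)))) sums of_real (\<Sum>j=0..r. ?t j)"
    by (simp add: higher_deriv_f_gamma del: of_nat_Suc)
  then have "(\<lambda>k. (deriv ^^ r) f_gamma (real (Suc k))) sums (\<Sum>j=0..r. ?t j)"
    by (simp only: sums_of_real_iff)
  also have "(\<Sum>j=0..r. ?t j) = ?t 0 + (\<Sum>j=1..r. ?t j)"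
    by (simp add: sum.atLeast_Suc_atMost)
  \<comment> \<open>The zeroth power of the logarithm is 1, so \<open>lnint 0\<close> is the
    interval length pi/3.\<close>
  also have "?t 0 = pi / (3 * sqrt 3) * c_gamma r"
    by simp
  \<comment> \<open>The sign comes from the minus in \<open>Ls\<close>: \<open>lnint j\<close>
    equals \<open>- Ls (j + 1) (pi / 3)\<close>.\<close>
  also have "(\<Sum>j=1..r. ?t j)
      = - (1 / sqrt 3 * (\<Sum>j=1..r. 2 ^ j * real (r choose j) * c_gamma (r - j) * Ls (j + 1) (pi / 3)))"
    unfolding sum_distrib_left sum_negf[symmetric]
    by (intro sum.cong) (simp_all add: Ls_def chord_def)
  finally show ?thesis
    by simp
qed

end
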